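(* Let $(M,g,Q,P)$ be a super-null Riemannian manifold equipped with an affine connection $\nabla$. If $\nabla$ is metric compatible, i.e. $X\langle Y|Z\rangle=\langle\nabla_XY|Z\rangle+(-1)^{\widetilde X\,\widetilde Y}\langle Y|\nabla_XZ\rangle$ for all (homogeneous) $X,Y,Z\in\mathrm{Vect}(M)$, then $\nabla$ cannot be torsionless, i.e. its torsion tensor $T_\nabla$ is non-zero.
   Context: Supermanifolds are real, finite-dimensional, in the Berezin–Leites (locally ringed space) sense, $M=(|M|,\mathcal{O}_M)$; $C^\infty(M)$ is the superalgebra of global functions, $\mathrm{Vect}(M)$ the $C^\infty(M)$-module of vector fields, $\widetilde{\cdot}$ denotes $\mathbb{Z}_2$-parity, and $[X,Y]=XY-(-1)^{\widetilde X\widetilde Y}YX$ is the graded commutator. A metric $g$ on $M$ is an even, graded-symmetric, rank 2 covariant tensor, possibly degenerate; it determines a pairing $\langle X|Y\rangle$ with $\widetilde{\langle X|Y\rangle}=\widetilde X+\widetilde Y$, $\langle X|Y\rangle=(-1)^{\widetilde X\widetilde Y}\langle Y|X\rangle$, $\langle fX+Y|Z\rangle=f\langle X|Z\rangle+\langle Y|Z\rangle$. Its kernel is $\ker(g)=\{X\in\mathrm{Vect}(M) : \langle X|Y\rangle=0\ \text{for all } Y\in\mathrm{Vect}(M)\}$; $g$ is degenerate if $\ker(g)\neq\{0\}$. A super-null Riemannian manifold is a quadruple $(M,g,Q,P)$ where $M$ is a supermanifold of dimension $n|1$ ($n\ge 1$), $g$ is a degenerate (even) metric on $M$, $Q\in\mathrm{Vect}(M)$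 is a non-singular odd vector field (i.e. its value in $T_mM$ is nonzero at every point $m\in|M|$) with $[Q,Q]=2P$ for an even vector field $P$, and $\ker(g)=\mathrm{Span}\{Q\}$ (the $C^\infty(M)$-span). It is part of the setting that the rank of the kernel is constant, equal to $0|1$ (at every point $m\in |M|$ the bilinear form induced by $g$ on $T_mM$ has kernel of dimension $0|1$), and that around every point of $|M|$ there are Shander coordinates $(x^a,t,\tau)$, with $x^a,t$ even and $\tau$ odd, in which $Q=\partial_\tau+\tau\partial_t$ and $P=\partial_t$. An affine connection on $M$ is a parity-preserving map $\nabla:\mathrm{Vect}(M)\times\mathrm{Vect}(M)\to\mathrm{Vect}(M)$, $(X,Y)\mapsto\nabla_XY$, that is biadditive, satisfies $\nabla_{fX}Y=f\nabla_XY$ and $\nabla_X(fY)=X(f)Y+(-1)^{\widetilde X\widetilde f}f\nabla_XY$ for $f\in C^\infty(M)$. Its torsion tensor is $T_\nabla(X,Y)=\nabla_XY-(-1)^{\widetilde X\widetilde Y}\nabla_YX-[X,Y]$ for homogeneous $X,Y$. *)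

theory Defs
  imports "HOL-Analysis.Analysis" "HOL-Algebra.Ring" "HOL-Library.Z2"
begin

section \<open>Superalgebras over the reals\<close>

text \<open>Parities are elements of the type \<^typ>\<open>bit\<close> of integers modulo 2.\<close>

definition ksign :: "bit \<Rightarrow> bit \<Rightarrow> real" where
  "ksign p q = (if p * q = 1 then - 1 else 1)"

text \<open>\<open>part A p\<close> is the set of homogeneous elements of parity \<open>p\<close>; zero belongs to both parts.\<close>

record 's superalg = "'s ring" +
  scale :: "real \<Rightarrow> 's \<Rightarrow> 's"
  part :: "bit \<Rightarrow> 's set"

definition supercomm_algebra :: "'s superalg \<Rightarrow> bool" where
  "supercomm_algebra A \<longleftrightarrow>
     ring A \<and>
     (\<forall>c. \<forall>x\<in>carrier A. scale A c x \<in> carrier A) \<and>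
     (\<forall>x\<in>carrier A. scale A 1 x = x) \<and>
     (\<forall>c d. \<forall>x\<in>carrier A. scale A c (scale A d x) = scale A (c * d) x) \<and>
     (\<forall>c d. \<forall>x\<in>carrier A. scale A (c + d) x = scale A c x \<oplus>\<^bsub>A\<^esub> scale A d x) \<and>
     (\<forall>c. \<forall>x\<in>carrier A. \<forall>y\<in>carrier A.
        scale A c (x \<oplus>\<^bsub>A\<^esub> y) = scale A c x \<oplus>\<^bsub>A\<^esub> scale A c y) \<and>
     (\<forall>c. \<forall>x\<in>carrier A. \<forall>y\<in>carrier A.
        scale A c (x \<otimes>\<^bsub>A\<^esub> y) = scale A c x \<otimes>\<^bsub>A\<^esub> y \<and>
        scale A c (x \<otimes>\<^bsub>A\<^esub> y) = x \<otimes>\<^bsub>A\<^esub> scale A c y) \<and>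
     (\<forall>p. part A p \<subseteq> carrier A \<and> \<zero>\<^bsub>A\<^esub> \<in> part A p) \<and>
     (\<forall>p. \<forall>x\<in>part A p. \<forall>y\<in>part A p. x \<oplus>\<^bsub>A\<^esub> y \<in> part A p) \<and>
     (\<forall>p c. \<forall>x\<in>part A p. scale A c x \<in> part A p) \<and>
     (\<forall>x\<in>carrier A. \<exists>!(y, z). y \<in> part A 0 \<and> z \<in> part A 1 \<and> x = y \<oplus>\<^bsub>A\<^esub> z) \<and>
     \<one>\<^bsub>A\<^esub> \<in> part A 0 \<and>
     (\<forall>p q. \<forall>x\<in>part A p. \<forall>y\<in>part A q.
        x \<otimes>\<^bsub>A\<^esub> y \<in> part A (p + q) \<and>
        x \<otimes>\<^bsub>A\<^esub> y = scale A (ksign p q) (y \<otimes>\<^bsub>A\<^esub> x))"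

definition superalg_hom :: "'s superalg \<Rightarrow> 't superalg \<Rightarrow> ('s \<Rightarrow> 't) set" where
  "superalg_hom A B = {h \<in> ring_hom A B.
     (\<forall>c. \<forall>x\<in>carrier A. h (scale A c x) = scale B c (h x)) \<and>
     (\<forall>p. h ` part A p \<subseteq> part B p)}"

definition superalg_iso :: "'s superalg \<Rightarrow> 't superalg \<Rightarrow> ('s \<Rightarrow> 't) set" where
  "superalg_iso A B = {h \<in> superalg_hom A B. bij_betw h (carrier A) (carrier B)}"


section \<open>Superspaces and supermanifolds\<close>

text \<open>\<open>body M\<close> is the topological space \<open>|M|\<close>, \<open>sheaf M U\<close> the superalgebra of sections over
  \<open>U\<close>, and \<open>res M U V\<close> the restriction of sections from \<open>U\<close> to \<open>V\<close>.\<close>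

record ('a, 's) superspace =
  body :: "'a topology"
  sheaf :: "'a set \<Rightarrow> 's superalg"
  res :: "'a set \<Rightarrow> 'a set \<Rightarrow> 's \<Rightarrow> 's"

definition superalg_sheaf :: "('a, 's) superspace \<Rightarrow> bool" where
  "superalg_sheaf M \<longleftrightarrow>
     (\<forall>U. openin (body M) U \<longrightarrow> supercomm_algebra (sheaf M U)) \<and>
     (\<forall>U V. openin (body M) U \<and> openin (body M) V \<and> V \<subseteq> U \<longrightarrow>
        res M U V \<in> superalg_hom (sheaf M U) (sheaf M V)) \<and>
     (\<forall>U. openin (body M) U \<longrightarrow> (\<forall>s\<in>carrier (sheaf M U). res M U U s = s)) \<and>
     (\<forall>U V W. openin (body M) U \<and> openin (body M) V \<and> openin (body M) W \<and> W \<subseteq> V \<and> V \<subseteq> U \<longrightarrow>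
        (\<forall>s\<in>carrier (sheaf M U). res M V W (res M U V s) = res M U W s)) \<and>
     (\<forall>\<U>. (\<forall>V\<in>\<U>. openin (body M) V) \<longrightarrow>
        (\<forall>s. (\<forall>V\<in>\<U>. s V \<in> carrier (sheaf M V)) \<and>
             (\<forall>V\<in>\<U>. \<forall>W\<in>\<U>. res M V (V \<inter> W) (s V) = res M W (V \<inter> W) (s W)) \<longrightarrow>
             (\<exists>!t. t \<in> carrier (sheaf M (\<Union>\<U>)) \<and> (\<forall>V\<in>\<U>. res M (\<Union>\<U>) V t = s V))))"

definition open_sub :: "('a, 's) superspace \<Rightarrow> 'a set \<Rightarrow> ('a, 's) superspace" where
  "open_sub M U = M\<lparr>body := subtopology (body M) U\<rparr>"

definition preim :: "('a, 's) superspace \<Rightarrow> ('a \<Rightarrow> 'b) \<Rightarrow> 'b set \<Rightarrow> 'a set" where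
  "preim M \<phi> V = {x \<in> topspace (body M). \<phi> x \<in> V}"

text \<open>An isomorphism \<open>(\<phi>, \<Phi>)\<close> of superspaces from \<open>M\<close> to \<open>N\<close>: a homeomorphism \<open>\<phi>\<close> of the underlying
  spaces and pull-back maps \<open>\<Phi> V\<close> from the sections of \<open>N\<close> over \<open>V\<close> to those of \<open>M\<close> over the
  preimage of \<open>V\<close>.\<close>

definition superspace_iso ::
  "('a, 's) superspace \<Rightarrow> ('b, 't) superspace \<Rightarrow> ('a \<Rightarrow> 'b) \<Rightarrow> ('b set \<Rightarrow> 't \<Rightarrow> 's) \<Rightarrow> bool" where
  "superspace_iso M N \<phi> \<Phi> \<longleftrightarrow>
     homeomorphic_map (body M) (body N) \<phi> \<and>
     (\<forall>V. openin (body N) V \<longrightarrow> \<Phi> V \<in> superalg_iso (sheaf N V) (sheaf M (preim M \<phi> V))) \<and>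
     (\<forall>V W. openin (body N) V \<and> openin (body N) W \<and> W \<subseteq> V \<longrightarrow>
        (\<forall>s\<in>carrier (sheaf N V).
           \<Phi> W (res N V W s) = res M (preim M \<phi> V) (preim M \<phi> W) (\<Phi> V s)))"

fun Ck_on :: "nat \<Rightarrow> (real ^ 'n) set \<Rightarrow> (real ^ 'n \<Rightarrow> real) \<Rightarrow> bool" where
  "Ck_on 0 W f \<longleftrightarrow> continuous_on W f"
| "Ck_on (Suc k) W f \<longleftrightarrow> f differentiable_on W \<and>
     (\<forall>i. Ck_on k W (\<lambda>x. frechet_derivative f (at x) (axis i 1)))"

definition Cinfinity_on :: "(real ^ 'n) set \<Rightarrow> (real ^ 'n \<Rightarrow> real) \<Rightarrow> bool" where
  "Cinfinity_on W f \<longleftrightarrow> (\<forall>k. Ck_on k W f)"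

text \<open>Sections of the superdomain of dimension \<open>n|q\<close> (with \<open>n = CARD('n)\<close>) over an open set \<open>W\<close>:
  a section \<open>\<Sum>\<^sub>I F\<^sub>I \<xi>\<^sub>I\<close>, where \<open>\<xi>\<^sub>I\<close> is the product of the generators \<open>\<xi>\<^sub>i\<close>, \<open>i \<in> I\<close>, in increasing
  order, is encoded by its coefficients \<open>I \<mapsto> F\<^sub>I\<close>, extended by zero to all sets \<open>I\<close> of naturals
  and to all points outside \<open>W\<close>.\<close>

type_synonym 'n grass = "nat set \<Rightarrow> real ^ 'n \<Rightarrow> real"

text \<open>The sign in \<open>\<xi>\<^sub>I \<xi>\<^sub>J = grass_sign I J \<xi>\<^bsub>I \<union> J\<^esub>\<close> for disjoint \<open>I\<close> and \<open>J\<close>.\<close>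

definition grass_sign :: "nat set \<Rightarrow> nat set \<Rightarrow> real" where
  "grass_sign I J = (- 1) ^ card {(i, j). i \<in> I \<and> j \<in> J \<and> j < i}"

definition grass_alg :: "nat \<Rightarrow> (real ^ 'n) set \<Rightarrow> 'n grass superalg" where
  "grass_alg q W = \<lparr>
     carrier = {F. (\<forall>I. Cinfinity_on W (F I)) \<and>
                   (\<forall>I x. \<not> (I \<subseteq> {..<q} \<and> x \<in> W) \<longrightarrow> F I x = 0)},
     mult = (\<lambda>F G K x. \<Sum>I\<in>Pow K. grass_sign I (K - I) * F I x * G (K - I) x),
     one = (\<lambda>I x. if I = {} \<and> x \<in> W then 1 else 0),
     zero = (\<lambda>I x. 0),
     add = (\<lambda>F G I x. F I x + G I x),
     scale = (\<lambda>c F I x. c * F I x),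
     part = (\<lambda>p. {F. (\<forall>I. Cinfinity_on W (F I)) \<and>
                   (\<forall>I x. \<not> (I \<subseteq> {..<q} \<and> x \<in> W \<and> of_nat (card I) = p) \<longrightarrow> F I x = 0)})\<rparr>"

definition Rsuper :: "nat \<Rightarrow> (real ^ 'n, 'n grass) superspace" where
  "Rsuper q = \<lparr>
     body = euclidean,
     sheaf = grass_alg q,
     res = (\<lambda>U V F I x. if x \<in> V then F I x else 0)\<rparr>"

text \<open>Supermanifolds of dimension \<open>n|q\<close> with \<open>n = CARD('n) \<ge> 1\<close>. Locality of the stalks is inherited
  from the superdomains.\<close>

definition supermanifold :: "'n::finite itself \<Rightarrow> nat \<Rightarrow> ('a, 's) superspace \<Rightarrow> bool" where
  "supermanifold TYPE('n) q M \<longleftrightarrow>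
     Hausdorff_space (body M) \<and> second_countable (body M) \<and> superalg_sheaf M \<and>
     (\<forall>m\<in>topspace (body M).
        \<exists>U (V :: (real ^ 'n) set) \<phi> \<Phi>. openin (body M) U \<and> m \<in> U \<and> open V \<and>
          superspace_iso (open_sub M U) (open_sub (Rsuper q) V) \<phi> \<Phi>)"

abbreviation Cinf :: "('a, 's) superspace \<Rightarrow> 's superalg" where
  "Cinf M \<equiv> sheaf M (topspace (body M))"

text \<open>The value at \<open>m\<close> of a section \<open>s\<close> over \<open>U\<close>: the unique real \<open>r\<close> such that the germ of \<open>s - r\<close>
  at \<open>m\<close> lies in the maximal ideal, i.e. is not invertible.\<close>

definition pt_eval :: "('a, 's) superspace \<Rightarrow> 'a \<Rightarrow> 'a set \<Rightarrow> 's \<Rightarrow> real" where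
  "pt_eval M m U s = (THE r. \<forall>V. openin (body M) V \<and> m \<in> V \<and> V \<subseteq> U \<longrightarrow>
     res M U V s \<oplus>\<^bsub>sheaf M V\<^esub> scale (sheaf M V) (- r) \<one>\<^bsub>sheaf M V\<^esub> \<notin> Units (sheaf M V))"


section \<open>Vector fields\<close>

text \<open>Vector fields are the global sections of the sheaf of superderivations of the structure sheaf:
  families of superderivations \<open>X U\<close> of the sections over \<open>U\<close>, for all open \<open>U\<close>, that commute with
  restrictions. The families are extensional (\<open>undefined\<close> off the open sets and off the carriers),
  so that equality of vector fields is equality in HOL.\<close>

type_synonym ('a, 's) vfield = "'a set \<Rightarrow> 's \<Rightarrow> 's"

definition hom_vf :: "('a, 's) superspace \<Rightarrow> bit \<Rightarrow> ('a, 's) vfield set" where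
  "hom_vf M p = {X \<in> extensional {U. openin (body M) U}.
     (\<forall>U. openin (body M) U \<longrightarrow>
        (let A = sheaf M U in
           X U \<in> carrier A \<rightarrow>\<^sub>E carrier A \<and>
           (\<forall>s\<in>carrier A. \<forall>t\<in>carrier A. X U (s \<oplus>\<^bsub>A\<^esub> t) = X U s \<oplus>\<^bsub>A\<^esub> X U t) \<and>
           (\<forall>c. \<forall>s\<in>carrier A. X U (scale A c s) = scale A c (X U s)) \<and>
           (\<forall>q. X U ` part A q \<subseteq> part A (p + q)) \<and>
           (\<forall>q. \<forall>s\<in>part A q. \<forall>t\<in>carrier A.
              X U (s \<otimes>\<^bsub>A\<^esub> t) = X U s \<otimes>\<^bsub>A\<^esub> t \<oplus>\<^bsub>A\<^esub> scale A (ksign p q) (s \<otimes>\<^bsub>A\<^esub> X U t)))) \<and>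
     (\<forall>U V. openin (body M) U \<and> openin (body M) V \<and> V \<subseteq> U \<longrightarrow>
        (\<forall>s\<in>carrier (sheaf M U). res M U V (X U s) = X V (res M U V s)))}"

text \<open>The family with components \<open>f U s\<close>, made extensional.\<close>

definition mk_vf :: "('a, 's) superspace \<Rightarrow> ('a set \<Rightarrow> 's \<Rightarrow> 's) \<Rightarrow> ('a, 's) vfield" where
  "mk_vf M f = (\<lambda>U\<in>{U. openin (body M) U}. \<lambda>s\<in>carrier (sheaf M U). f U s)"

definition vf_zero :: "('a, 's) superspace \<Rightarrow> ('a, 's) vfield" where
  "vf_zero M = mk_vf M (\<lambda>U s. \<zero>\<^bsub>sheaf M U\<^esub>)"

definition vf_add ::
  "('a, 's) superspace \<Rightarrow> ('a, 's) vfield \<Rightarrow> ('a, 's) vfield \<Rightarrow> ('a, 's) vfield" where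
  "vf_add M X Y = mk_vf M (\<lambda>U s. X U s \<oplus>\<^bsub>sheaf M U\<^esub> Y U s)"

definition vf_scale :: "('a, 's) superspace \<Rightarrow> real \<Rightarrow> ('a, 's) vfield \<Rightarrow> ('a, 's) vfield" where
  "vf_scale M c X = mk_vf M (\<lambda>U s. scale (sheaf M U) c (X U s))"

definition vf_diff ::
  "('a, 's) superspace \<Rightarrow> ('a, 's) vfield \<Rightarrow> ('a, 's) vfield \<Rightarrow> ('a, 's) vfield" where
  "vf_diff M X Y = vf_add M X (vf_scale M (- 1) Y)"

definition vf_smult :: "('a, 's) superspace \<Rightarrow> 's \<Rightarrow> ('a, 's) vfield \<Rightarrow> ('a, 's) vfield" where
  "vf_smult M f X = mk_vf M (\<lambda>U s. res M (topspace (body M)) U f \<otimes>\<^bsub>sheaf M U\<^esub> X U s)"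

definition Vect :: "('a, 's) superspace \<Rightarrow> ('a, 's) vfield set" where
  "Vect M = {vf_add M X Y | X Y. X \<in> hom_vf M 0 \<and> Y \<in> hom_vf M 1}"

abbreviation vf_apply :: "('a, 's) superspace \<Rightarrow> ('a, 's) vfield \<Rightarrow> 's \<Rightarrow> 's" where
  "vf_apply M X f \<equiv> X (topspace (body M)) f"

text \<open>The graded commutator of \<open>X\<close> of parity \<open>p\<close> and \<open>Y\<close> of parity \<open>q\<close>.\<close>

definition vf_commutator ::
  "('a, 's) superspace \<Rightarrow> bit \<Rightarrow> bit \<Rightarrow> ('a, 's) vfield \<Rightarrow> ('a, 's) vfield \<Rightarrow> ('a, 's) vfield" where
  "vf_commutator M p q X Y =
     vf_diff M (mk_vf M (\<lambda>U s. X U (Y U s)))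
       (vf_scale M (ksign p q) (mk_vf M (\<lambda>U s. Y U (X U s))))"


section \<open>Tangent spaces\<close>

text \<open>Tangent vectors at \<open>m\<close> are superderivations at \<open>m\<close> from the stalk to the reals. A linear map on
  the stalk, which is a direct limit, is given by a compatible family of linear maps \<open>v U\<close> on the
  sections over the open neighbourhoods \<open>U\<close> of \<open>m\<close>; the family is extended by zero. The reals being
  purely even, a map of parity \<open>p\<close> vanishes on sections of parity other than \<open>p\<close>.\<close>

type_synonym ('a, 's) tvector = "'a set \<Rightarrow> 's \<Rightarrow> real"

definition hom_tvec :: "('a, 's) superspace \<Rightarrow> 'a \<Rightarrow> bit \<Rightarrow> ('a, 's) tvector set" where
  "hom_tvec M m p = {v.
     (\<forall>U s. \<not> (openin (body M) U \<and> m \<in> U \<and> s \<in> carrier (sheaf M U)) \<longrightarrow> v U s = 0) \<and>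
     (\<forall>U. openin (body M) U \<and> m \<in> U \<longrightarrow>
        (let A = sheaf M U in
           (\<forall>s\<in>carrier A. \<forall>t\<in>carrier A. v U (s \<oplus>\<^bsub>A\<^esub> t) = v U s + v U t) \<and>
           (\<forall>c. \<forall>s\<in>carrier A. v U (scale A c s) = c * v U s) \<and>
           (\<forall>q. q \<noteq> p \<longrightarrow> (\<forall>s\<in>part A q. v U s = 0)) \<and>
           (\<forall>q. \<forall>s\<in>part A q. \<forall>t\<in>carrier A.
              v U (s \<otimes>\<^bsub>A\<^esub> t) = v U s * pt_eval M m U t + ksign p q * pt_eval M m U s * v U t))) \<and>
     (\<forall>U V. openin (body M) U \<and> openin (body M) V \<and> m \<in> V \<and> V \<subseteq> U \<longrightarrow>
        (\<forall>s\<in>carrier (sheaf M U). v V (res M U V s) = v U s))}"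

definition tangent_space :: "('a, 's) superspace \<Rightarrow> 'a \<Rightarrow> ('a, 's) tvector set" where
  "tangent_space M m = {\<lambda>U s. v U s + w U s | v w. v \<in> hom_tvec M m 0 \<and> w \<in> hom_tvec M m 1}"

definition vf_at :: "('a, 's) superspace \<Rightarrow> 'a \<Rightarrow> ('a, 's) vfield \<Rightarrow> ('a, 's) tvector" where
  "vf_at M m X = (\<lambda>U s. if openin (body M) U \<and> m \<in> U \<and> s \<in> carrier (sheaf M U)
     then pt_eval M m U (X U s) else 0)"

definition nonsingular :: "('a, 's) superspace \<Rightarrow> ('a, 's) vfield \<Rightarrow> bool" where
  "nonsingular M X \<longleftrightarrow> (\<forall>m\<in>topspace (body M). vf_at M m X \<noteq> (\<lambda>U s. 0))"


section \<open>Metrics\<close>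

text \<open>A metric is represented by its pairing of vector fields. Biadditivity is required outright, as
  additivity in the second argument follows from graded symmetry only within one parity.\<close>

type_synonym ('a, 's) pairing = "('a, 's) vfield \<Rightarrow> ('a, 's) vfield \<Rightarrow> 's"

definition metric :: "('a, 's) superspace \<Rightarrow> ('a, 's) pairing \<Rightarrow> bool" where
  "metric M g \<longleftrightarrow>
     (\<forall>X\<in>Vect M. \<forall>Y\<in>Vect M. g X Y \<in> carrier (Cinf M)) \<and>
     (\<forall>X\<in>Vect M. \<forall>Y\<in>Vect M. \<forall>Z\<in>Vect M.
        g (vf_add M X Y) Z = g X Z \<oplus>\<^bsub>Cinf M\<^esub> g Y Z \<and>
        g X (vf_add M Y Z) = g X Y \<oplus>\<^bsub>Cinf M\<^esub> g X Z) \<and>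
     (\<forall>f\<in>carrier (Cinf M). \<forall>X\<in>Vect M. \<forall>Y\<in>Vect M.
        g (vf_smult M f X) Y = f \<otimes>\<^bsub>Cinf M\<^esub> g X Y) \<and>
     (\<forall>p q. \<forall>X\<in>hom_vf M p. \<forall>Y\<in>hom_vf M q.
        g X Y \<in> part (Cinf M) (p + q) \<and>
        g X Y = scale (Cinf M) (ksign p q) (g Y X))"

definition metric_kernel :: "('a, 's) superspace \<Rightarrow> ('a, 's) pairing \<Rightarrow> ('a, 's) vfield set" where
  "metric_kernel M g = {X \<in> Vect M. \<forall>Y\<in>Vect M. g X Y = \<zero>\<^bsub>Cinf M\<^esub>}"

definition degenerate :: "('a, 's) superspace \<Rightarrow> ('a, 's) pairing \<Rightarrow> bool" where
  "degenerate M g \<longleftrightarrow> metric_kernel M g \<noteq> {vf_zero M}"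

text \<open>The bilinear form induced on the tangent space at \<open>m\<close>: every tangent vector is the value of some
  vector field, and the value of the pairing at \<open>m\<close> depends on the values at \<open>m\<close> only.\<close>

definition form_at ::
  "('a, 's) superspace \<Rightarrow> ('a, 's) pairing \<Rightarrow> 'a \<Rightarrow> ('a, 's) tvector \<Rightarrow> ('a, 's) tvector \<Rightarrow> real" where
  "form_at M g m v w = (THE r. \<exists>X\<in>Vect M. \<exists>Y\<in>Vect M.
     vf_at M m X = v \<and> vf_at M m Y = w \<and> r = pt_eval M m (topspace (body M)) (g X Y))"

definition form_kernel ::
  "('a, 's) superspace \<Rightarrow> ('a, 's) pairing \<Rightarrow> 'a \<Rightarrow> ('a, 's) tvector set" where
  "form_kernel M g m = {v \<in> tangent_space M m. \<forall>w\<in>tangent_space M m. form_at M g m v w = 0}"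

text \<open>The kernel is a line spanned by an odd tangent vector, i.e. has dimension \<open>0|1\<close>, at every
  point.\<close>

definition kernel_rank_01 :: "('a, 's) superspace \<Rightarrow> ('a, 's) pairing \<Rightarrow> bool" where
  "kernel_rank_01 M g \<longleftrightarrow> (\<forall>m\<in>topspace (body M).
     \<exists>v\<in>hom_tvec M m 1. v \<noteq> (\<lambda>U s. 0) \<and> form_kernel M g m = {\<lambda>U s. c * v U s | c. True})"


section \<open>Super-null Riemannian manifolds\<close>

definition pd_even :: "'n \<Rightarrow> (real ^ 'n) set \<Rightarrow> 'n grass \<Rightarrow> 'n grass" where
  "pd_even i W F = (\<lambda>I x. if x \<in> W then frechet_derivative (F I) (at x) (axis i 1) else 0)"

text \<open>The left derivative with respect to \<open>\<xi>\<^sub>j\<close>; the sign moves \<open>\<xi>\<^sub>j\<close> to the front.\<close>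

definition pd_odd :: "nat \<Rightarrow> 'n grass \<Rightarrow> 'n grass" where
  "pd_odd j F = (\<lambda>I x. if j \<in> I then 0 else (- 1) ^ card {i \<in> I. i < j} * F (insert j I) x)"

definition odd_coord :: "nat \<Rightarrow> (real ^ 'n) set \<Rightarrow> 'n grass" where
  "odd_coord j W = (\<lambda>I x. if I = {j} \<and> x \<in> W then 1 else 0)"

text \<open>In the chart \<open>(\<phi>, \<Phi>)\<close> of \<open>M\<close> over \<open>U\<close>, with image \<open>V\<close>, the even coordinates are the pull-backs of
  the standard ones, \<open>t\<close> being the one with index \<open>i\<close>, and \<open>\<tau>\<close> is the pull-back of \<open>\<xi>\<^sub>0\<close>. The
  coordinate expressions of \<open>Q\<close> and \<open>P\<close> are tested on pull-backs of sections over all open subsets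
  of \<open>V\<close>.\<close>

definition shander_chart ::
  "('a, 's) superspace \<Rightarrow> ('a, 's) vfield \<Rightarrow> ('a, 's) vfield \<Rightarrow> 'a set \<Rightarrow> (real ^ 'n) set \<Rightarrow>
   ('a \<Rightarrow> real ^ 'n) \<Rightarrow> ((real ^ 'n) set \<Rightarrow> 'n grass \<Rightarrow> 's) \<Rightarrow> 'n \<Rightarrow> bool" where
  "shander_chart M Q P U V \<phi> \<Phi> i \<longleftrightarrow>
     openin (body M) U \<and> open V \<and>
     superspace_iso (open_sub M U) (open_sub (Rsuper 1) V) \<phi> \<Phi> \<and>
     (\<forall>W. open W \<and> W \<subseteq> V \<longrightarrow>
        (let A = grass_alg 1 W; U' = preim (open_sub M U) \<phi> W in
         \<forall>F\<in>carrier A.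
           Q U' (\<Phi> W F) = \<Phi> W (pd_odd 0 F \<oplus>\<^bsub>A\<^esub> odd_coord 0 W \<otimes>\<^bsub>A\<^esub> pd_even i W F) \<and>
           P U' (\<Phi> W F) = \<Phi> W (pd_even i W F)))"

definition super_null ::
  "'n::finite itself \<Rightarrow> ('a, 's) superspace \<Rightarrow> ('a, 's) pairing \<Rightarrow>
   ('a, 's) vfield \<Rightarrow> ('a, 's) vfield \<Rightarrow> bool" where
  "super_null TYPE('n) M g Q P \<longleftrightarrow>
     supermanifold TYPE('n) 1 M \<and>
     metric M g \<and> degenerate M g \<and>
     Q \<in> hom_vf M 1 \<and> nonsingular M Q \<and>
     P \<in> hom_vf M 0 \<and> vf_commutator M 1 1 Q Q = vf_scale M 2 P \<and>
     metric_kernel M g = {vf_smult M f Q | f. f \<in> carrier (Cinf M)} \<and>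
     kernel_rank_01 M g \<and>
     (\<forall>m\<in>topspace (body M). \<exists>U (V :: (real ^ 'n) set) \<phi> \<Phi> i.
        m \<in> U \<and> shander_chart M Q P U V \<phi> \<Phi> i)"


section \<open>Affine connections\<close>

type_synonym ('a, 's) connection = "('a, 's) vfield \<Rightarrow> ('a, 's) vfield \<Rightarrow> ('a, 's) vfield"

definition affine_connection :: "('a, 's) superspace \<Rightarrow> ('a, 's) connection \<Rightarrow> bool" where
  "affine_connection M nabla \<longleftrightarrow>
     (\<forall>X\<in>Vect M. \<forall>Y\<in>Vect M. nabla X Y \<in> Vect M) \<and>
     (\<forall>p q. \<forall>X\<in>hom_vf M p. \<forall>Y\<in>hom_vf M q. nabla X Y \<in> hom_vf M (p + q)) \<and>
     (\<forall>X\<in>Vect M. \<forall>Y\<in>Vect M. \<forall>Z\<in>Vect M.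
        nabla (vf_add M X Y) Z = vf_add M (nabla X Z) (nabla Y Z) \<and>
        nabla X (vf_add M Y Z) = vf_add M (nabla X Y) (nabla X Z)) \<and>
     (\<forall>f\<in>carrier (Cinf M). \<forall>X\<in>Vect M. \<forall>Y\<in>Vect M.
        nabla (vf_smult M f X) Y = vf_smult M f (nabla X Y)) \<and>
     (\<forall>p q. \<forall>X\<in>hom_vf M p. \<forall>f\<in>part (Cinf M) q. \<forall>Y\<in>Vect M.
        nabla X (vf_smult M f Y) =
          vf_add M (vf_smult M (vf_apply M X f) Y)
                   (vf_scale M (ksign p q) (vf_smult M f (nabla X Y))))"

definition metric_compatible ::
  "('a, 's) superspace \<Rightarrow> ('a, 's) pairing \<Rightarrow> ('a, 's) connection \<Rightarrow> bool" where
  "metric_compatible M g nabla \<longleftrightarrow>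
     (\<forall>p q r. \<forall>X\<in>hom_vf M p. \<forall>Y\<in>hom_vf M q. \<forall>Z\<in>hom_vf M r.
        vf_apply M X (g Y Z) =
          g (nabla X Y) Z \<oplus>\<^bsub>Cinf M\<^esub> scale (Cinf M) (ksign p q) (g Y (nabla X Z)))"

text \<open>The torsion tensor on \<open>X\<close> of parity \<open>p\<close> and \<open>Y\<close> of parity \<open>q\<close>.\<close>

definition torsion ::
  "('a, 's) superspace \<Rightarrow> ('a, 's) connection \<Rightarrow> bit \<Rightarrow> bit \<Rightarrow>
   ('a, 's) vfield \<Rightarrow> ('a, 's) vfield \<Rightarrow> ('a, 's) vfield" where
  "torsion M nabla p q X Y =
     vf_diff M (vf_diff M (nabla X Y) (vf_scale M (ksign p q) (nabla Y X)))
       (vf_commutator M p q X Y)"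

definition torsionless :: "('a, 's) superspace \<Rightarrow> ('a, 's) connection \<Rightarrow> bool" where
  "torsionless M nabla \<longleftrightarrow>
     (\<forall>p q. \<forall>X\<in>hom_vf M p. \<forall>Y\<in>hom_vf M q. torsion M nabla p q X Y = vf_zero M)"

end

theory Submission
  imports Defs
begin

text \<open>If \<open>\<nabla>\<close> is metric compatible, then \<open>\<nabla>\<^sub>Q Q\<close> lies in the kernel of the metric, because
  \<open>\<langle>Q|_\<rangle> = 0\<close>; hence \<open>\<nabla>\<^sub>Q Q = f Q\<close>. As \<open>Q\<close> is odd, vanishing torsion forces
  \<open>2 \<nabla>\<^sub>Q Q = [Q, Q] = 2 P\<close>, so \<open>P = f Q\<close>. In Shander coordinates, applying this to \<open>\<tau>\<close> gives
  \<open>0 = f\<close>, and applying it to \<open>t\<close> then gives \<open>1 = 0\<close>.\<close>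

section \<open>Signs and real scalars in a supercommutative algebra\<close>

lemma ksign_1_1 [simp]: "ksign 1 1 = - 1"
  by (simp add: ksign_def)

context
  fixes A :: "'s superalg"
  assumes A: "supercomm_algebra A"
begin

lemma supercomm_algebra_ring: "ring A"
  using A unfolding supercomm_algebra_def by (elim conjE)

lemma supercomm_algebra_scale_closed [rule_format]:
  "\<forall>c. \<forall>x\<in>carrier A. scale A c x \<in> carrier A"
  using A unfolding supercomm_algebra_def by (elim conjE)

lemma supercomm_algebra_scale_1 [rule_format]: "\<forall>x\<in>carrier A. scale A 1 x = x"
  using A unfolding supercomm_algebra_def by (elim conjE)

lemma supercomm_algebra_scale_scale [rule_format]:
  "\<forall>c d. \<forall>x\<in>carrier A. scale A c (scale A d x) = scale A (c * d) x"
  using A unfolding supercomm_algebra_def by (elim conjE)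

lemma supercomm_algebra_scale_add_left [rule_format]:
  "\<forall>c d. \<forall>x\<in>carrier A. scale A (c + d) x = scale A c x \<oplus>\<^bsub>A\<^esub> scale A d x"
  using A unfolding supercomm_algebra_def by (elim conjE)

lemma supercomm_algebra_scale_add_right [rule_format]:
  "\<forall>c. \<forall>x\<in>carrier A. \<forall>y\<in>carrier A.
    scale A c (x \<oplus>\<^bsub>A\<^esub> y) = scale A c x \<oplus>\<^bsub>A\<^esub> scale A c y"
  using A unfolding supercomm_algebra_def by (elim conjE)

lemma supercomm_algebra_part: "\<forall>p. part A p \<subseteq> carrier A \<and> \<zero>\<^bsub>A\<^esub> \<in> part A p"
  using A unfolding supercomm_algebra_def by (elim conjE)

lemma supercomm_algebra_zero_in_part: "\<zero>\<^bsub>A\<^esub> \<in> part A p"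
  using supercomm_algebra_part by simp

lemma supercomm_algebra_part_subset: "x \<in> part A p \<Longrightarrow> x \<in> carrier A"
  using supercomm_algebra_part by blast

lemma supercomm_algebra_scale_zero_left:
  assumes x: "x \<in> carrier A" shows "scale A 0 x = \<zero>\<^bsub>A\<^esub>"
proof -
  interpret ring A by (rule supercomm_algebra_ring)
  have "scale A 0 x \<oplus>\<^bsub>A\<^esub> scale A 0 x = scale A 0 x"
    using supercomm_algebra_scale_add_left[OF x, of 0 0] by simp
  then show ?thesis
    using supercomm_algebra_scale_closed[OF x, of 0] by (simp add: add.l_cancel_one)
qed

text \<open>Zero is itself a multiple by the scalar 0, so scaling it by \<open>c\<close> amounts to
  scaling it by \<open>c * 0\<close>.\<close>

lemma supercomm_algebra_scale_zero_right: "scale A c \<zero>\<^bsub>A\<^esub> = \<zero>\<^bsub>A\<^esub>"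
proof -
  interpret ring A by (rule supercomm_algebra_ring)
  show ?thesis
    using supercomm_algebra_scale_scale[of "\<zero>\<^bsub>A\<^esub>" c 0] supercomm_algebra_scale_zero_left[of "\<zero>\<^bsub>A\<^esub>"]
    by simp
qed

text \<open>The hypothesis has the shape that vanishing torsion takes on the pair (Q, Q), for odd Q
  with [Q, Q] = 2 P, when evaluated on a section: \<open>a\<close> and \<open>b\<close> stand for
  the values of \<open>nabla Q Q\<close> and \<open>P\<close>. The two signs before the second
  \<open>a\<close> cancel, and the common factor 2 is then inverted by a real scalar.\<close>

lemma supercomm_algebra_eq_if_double_eq:
  assumes a: "a \<in> carrier A" and b: "b \<in> carrier A"
    and eq: "(a \<oplus>\<^bsub>A\<^esub> scale A (- 1) (scale A (- 1) a)) \<oplus>\<^bsub>A\<^esub> scale A (- 1) (scale A 2 b) = \<zero>\<^bsub>A\<^esub>"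
  shows "a = b"
proof -
  interpret ring A by (rule supercomm_algebra_ring)
  note closed = supercomm_algebra_scale_closed
  have "a \<oplus>\<^bsub>A\<^esub> scale A (- 1) (scale A (- 1) a) = scale A 2 a"
    using supercomm_algebra_scale_add_left[OF a, of 1 1] a
    by (simp add: supercomm_algebra_scale_scale supercomm_algebra_scale_1)
  with eq b have "scale A 2 a \<oplus>\<^bsub>A\<^esub> scale A (- 2) b = \<zero>\<^bsub>A\<^esub>"
    by (simp add: supercomm_algebra_scale_scale)
  then have "scale A (1/2) (scale A 2 a \<oplus>\<^bsub>A\<^esub> scale A (- 2) b) = \<zero>\<^bsub>A\<^esub>"
    by (simp add: supercomm_algebra_scale_zero_right)
  then have 1: "a \<oplus>\<^bsub>A\<^esub> scale A (- 1) b = \<zero>\<^bsub>A\<^esub>"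
    using a b closed
    by (simp add: supercomm_algebra_scale_add_right supercomm_algebra_scale_scale
        supercomm_algebra_scale_1)
  \<comment> \<open>Both \<open>a\<close> and \<open>b\<close> are now additive inverses of the same
    element, hence equal by cancellation.\<close>
  have 2: "b \<oplus>\<^bsub>A\<^esub> scale A (- 1) b = \<zero>\<^bsub>A\<^esub>"
    using supercomm_algebra_scale_add_left[OF b, of 1 "- 1"] b
    by (simp add: supercomm_algebra_scale_1 supercomm_algebra_scale_zero_left)
  show ?thesis
    using 1 2 a b closed[OF b, of "- 1"] by (metis add.right_cancel)
qed

end

lemma superalg_hom_zero:
  assumes "supercomm_algebra A" "supercomm_algebra B" "h \<in> superalg_hom A B"
  shows "h \<zero>\<^bsub>A\<^esub> = \<zero>\<^bsub>B\<^esub>"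
  using assms supercomm_algebra_ring[OF assms(1)] supercomm_algebra_ring[OF assms(2)]
  by (auto simp: superalg_hom_def intro: ring_hom_zero)

section \<open>Vector fields as extensional families; closure properties of metrics and
  connections\<close>

lemma hom_vf_PiE:
  assumes "X \<in> hom_vf M p" "openin (body M) U"
  shows "X U \<in> carrier (sheaf M U) \<rightarrow>\<^sub>E carrier (sheaf M U)"
  using assms by (simp add: hom_vf_def Let_def)

lemma hom_vf_closed:
  "X \<in> hom_vf M p \<Longrightarrow> openin (body M) U \<Longrightarrow> s \<in> carrier (sheaf M U) \<Longrightarrow> X U s \<in> carrier (sheaf M U)"
  using hom_vf_PiE by (rule PiE_mem)

text \<open>Both sides are \<open>undefined\<close> off the open sets and off the carriers. This is
  what turns equality on all sections into equality of vector fields.\<close>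

lemma hom_vf_extensional:
  assumes "X \<in> hom_vf M p"
  shows "mk_vf M X = X"
proof
  fix U
  show "mk_vf M X U = X U"
  proof (cases "openin (body M) U")
    case True
    then have "X U \<in> extensional (carrier (sheaf M U))"
      using hom_vf_PiE[OF assms] by (simp add: PiE_def)
    then show ?thesis using True by (simp add: mk_vf_def extensional_restrict)
  next
    case False
    then show ?thesis using assms by (simp add: mk_vf_def hom_vf_def extensional_def)
  qed
qed

lemma mk_vf_cong:
  "(\<And>U s. openin (body M) U \<Longrightarrow> s \<in> carrier (sheaf M U) \<Longrightarrow> f U s = h U s) \<Longrightarrow> mk_vf M f = mk_vf M h"
  unfolding mk_vf_def by (intro restrict_ext) simp

lemma mk_vf_eqI:
  assumes "X \<in> hom_vf M p"
    and "\<And>U s. openin (body M) U \<Longrightarrow> s \<in> carrier (sheaf M U) \<Longrightarrow> f U s = X U s"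
  shows "mk_vf M f = X"
  using mk_vf_cong[OF assms(2)] hom_vf_extensional[OF assms(1)] by (rule trans)

lemma mk_vf_apply:
  "openin (body M) U \<Longrightarrow> s \<in> carrier (sheaf M U) \<Longrightarrow> mk_vf M f U s = f U s"
  by (simp add: mk_vf_def)

lemma metric_closed:
  assumes "metric M g" "X \<in> Vect M" "Y \<in> Vect M"
  shows "g X Y \<in> carrier (Cinf M)"
  using assms(1)[unfolded metric_def, THEN conjunct1] assms(2,3) by blast

lemma metric_add_right:
  assumes "metric M g" "X \<in> Vect M" "Y \<in> Vect M" "Z \<in> Vect M"
  shows "g X (vf_add M Y Z) = g X Y \<oplus>\<^bsub>Cinf M\<^esub> g X Z"
  using assms(1)[unfolded metric_def, THEN conjunct2, THEN conjunct1] assms(2-4) by blast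

lemma affine_connection_closed:
  assumes "affine_connection M nabla" "X \<in> Vect M" "Y \<in> Vect M"
  shows "nabla X Y \<in> Vect M"
  using assms(1)[unfolded affine_connection_def, THEN conjunct1] assms(2,3) by blast

lemma affine_connection_hom_vf:
  assumes "affine_connection M nabla" "X \<in> hom_vf M p" "Y \<in> hom_vf M q"
  shows "nabla X Y \<in> hom_vf M (p + q)"
  using assms(1)[unfolded affine_connection_def, THEN conjunct2, THEN conjunct1] assms(2,3) by blast

section \<open>Vector fields over a sheaf of superalgebras, and the connection on the metric
  kernel\<close>

context
  fixes M :: "('a, 's) superspace"
  assumes M: "superalg_sheaf M"
begin

lemma superalg_sheaf_supercomm_algebra [rule_format]:
  "\<forall>U. openin (body M) U \<longrightarrow> supercomm_algebra (sheaf M U)"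
  using M unfolding superalg_sheaf_def by (elim conjE)

lemma superalg_sheaf_res_hom:
  assumes "openin (body M) U" "openin (body M) V" "V \<subseteq> U"
  shows "res M U V \<in> superalg_hom (sheaf M U) (sheaf M V)"
proof -
  have "\<forall>U V. openin (body M) U \<and> openin (body M) V \<and> V \<subseteq> U \<longrightarrow>
      res M U V \<in> superalg_hom (sheaf M U) (sheaf M V)"
    using M unfolding superalg_sheaf_def by (elim conjE)
  then show ?thesis using assms by blast
qed

text \<open>The zero field has both parities because zero lies in both parts of every algebra of
  sections. It serves as the missing summand when a homogeneous field is written as an even plus an
  odd one.\<close>

lemma vf_zero_in_hom_vf: "vf_zero M \<in> hom_vf M p"
proof -
  have "(let A = sheaf M U in
           vf_zero M U \<in> carrier A \<rightarrow>\<^sub>E carrier A \<and>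
           (\<forall>s\<in>carrier A. \<forall>t\<in>carrier A. vf_zero M U (s \<oplus>\<^bsub>A\<^esub> t) = vf_zero M U s \<oplus>\<^bsub>A\<^esub> vf_zero M U t) \<and>
           (\<forall>c. \<forall>s\<in>carrier A. vf_zero M U (scale A c s) = scale A c (vf_zero M U s)) \<and>
           (\<forall>q. vf_zero M U ` part A q \<subseteq> part A (p + q)) \<and>
           (\<forall>q. \<forall>s\<in>part A q. \<forall>t\<in>carrier A.
              vf_zero M U (s \<otimes>\<^bsub>A\<^esub> t) =
                vf_zero M U s \<otimes>\<^bsub>A\<^esub> t \<oplus>\<^bsub>A\<^esub> scale A (ksign p q) (s \<otimes>\<^bsub>A\<^esub> vf_zero M U t)))"
    if U: "openin (body M) U" for U
  proof -
    note A = superalg_sheaf_supercomm_algebra[OF U]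
    interpret ring "sheaf M U" by (rule supercomm_algebra_ring[OF A])
    show ?thesis
      using U by (auto simp: Let_def vf_zero_def mk_vf_def supercomm_algebra_scale_closed[OF A]
          supercomm_algebra_scale_zero_right[OF A] supercomm_algebra_zero_in_part[OF A]
          dest: supercomm_algebra_part_subset[OF A])
  qed
  moreover have "res M U V (vf_zero M U s) = vf_zero M V (res M U V s)"
    if U: "openin (body M) U" and V: "openin (body M) V" and "V \<subseteq> U"
      and s: "s \<in> carrier (sheaf M U)" for U V s
  proof -
    have h: "res M U V \<in> superalg_hom (sheaf M U) (sheaf M V)"
      using superalg_sheaf_res_hom that by blast
    then have "res M U V s \<in> carrier (sheaf M V)"
      using s by (auto simp: superalg_hom_def ring_hom_def)
    moreover have "res M U V \<zero>\<^bsub>sheaf M U\<^esub> = \<zero>\<^bsub>sheaf M V\<^esub>"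
      using superalg_hom_zero h U V superalg_sheaf_supercomm_algebra by blast
    ultimately show ?thesis
      using U V s by (simp add: vf_zero_def mk_vf_def)
  qed
  moreover have "vf_zero M \<in> extensional {U. openin (body M) U}"
    by (simp add: vf_zero_def mk_vf_def)
  ultimately show ?thesis
    unfolding hom_vf_def by blast
qed

lemma vf_add_zero:
  assumes X: "X \<in> hom_vf M p"
  shows "vf_add M X (vf_zero M) = X" "vf_add M (vf_zero M) X = X"
proof -
  have "X U s \<oplus>\<^bsub>sheaf M U\<^esub> vf_zero M U s = X U s \<and> vf_zero M U s \<oplus>\<^bsub>sheaf M U\<^esub> X U s = X U s"
    if "openin (body M) U" "s \<in> carrier (sheaf M U)" for U s
  proof -
    interpret ring "sheaf M U"
      by (rule supercomm_algebra_ring[OF superalg_sheaf_supercomm_algebra[OF that(1)]])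
    show ?thesis using hom_vf_closed[OF X that] that by (simp add: vf_zero_def mk_vf_apply)
  qed
  then show "vf_add M X (vf_zero M) = X" "vf_add M (vf_zero M) X = X"
    unfolding vf_add_def by (blast intro: mk_vf_eqI[OF X])+
qed

lemma hom_vf_subset_Vect:
  assumes X: "X \<in> hom_vf M p" shows "X \<in> Vect M"
proof (cases p)
  case zero
  then show ?thesis
    unfolding Vect_def using X vf_add_zero(1)[OF X] vf_zero_in_hom_vf[of 1] by force
next
  case one
  then show ?thesis
    unfolding Vect_def using X vf_add_zero(2)[OF X] vf_zero_in_hom_vf[of 0] by force
qed

lemma hom_vf_zero:
  assumes X: "X \<in> hom_vf M p" and U: "openin (body M) U"
  shows "X U \<zero>\<^bsub>sheaf M U\<^esub> = \<zero>\<^bsub>sheaf M U\<^esub>"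
proof -
  note A = superalg_sheaf_supercomm_algebra[OF U]
  interpret ring "sheaf M U" by (rule supercomm_algebra_ring[OF A])
  have "X U (scale (sheaf M U) 0 \<zero>\<^bsub>sheaf M U\<^esub>) = scale (sheaf M U) 0 (X U \<zero>\<^bsub>sheaf M U\<^esub>)"
    using X U by (simp add: hom_vf_def Let_def)
  then show ?thesis
    using hom_vf_closed[OF X U] by (simp add: supercomm_algebra_scale_zero_left[OF A])
qed

lemma vf_smult_one:
  assumes X: "X \<in> hom_vf M p"
  shows "vf_smult M \<one>\<^bsub>Cinf M\<^esub> X = X"
proof -
  have "res M (topspace (body M)) U \<one>\<^bsub>Cinf M\<^esub> \<otimes>\<^bsub>sheaf M U\<^esub> X U s = X U s"
    if U: "openin (body M) U" and s: "s \<in> carrier (sheaf M U)" for U s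
  proof -
    interpret ring "sheaf M U"
      by (rule supercomm_algebra_ring[OF superalg_sheaf_supercomm_algebra[OF U]])
    have "res M (topspace (body M)) U \<one>\<^bsub>Cinf M\<^esub> = \<one>\<^bsub>sheaf M U\<^esub>"
      using superalg_sheaf_res_hom[OF openin_topspace U openin_subset[OF U]]
      by (simp add: superalg_hom_def ring_hom_one)
    then show ?thesis using hom_vf_closed[OF X U s] by simp
  qed
  then show ?thesis
    unfolding vf_smult_def by (rule mk_vf_eqI[OF X])
qed

text \<open>In the compatibility identity for X, K and Z, the left side is X applied to zero and the
  last term pairs K with a vector field. Both vanish since K is in the kernel, which leaves the
  pairing of \<open>nabla X K\<close> with Z equal to zero.\<close>

lemma nabla_in_metric_kernel:
  assumes g: "metric M g" and nabla: "affine_connection M nabla"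
    and compat: "metric_compatible M g nabla"
    and X: "X \<in> hom_vf M p" and K: "K \<in> hom_vf M q" "K \<in> metric_kernel M g"
  shows "nabla X K \<in> metric_kernel M g"
proof -
  let ?T = "topspace (body M)"
  note A = superalg_sheaf_supercomm_algebra[OF openin_topspace]
  interpret ring "Cinf M" by (rule supercomm_algebra_ring[OF A])
  have K0: "g K Z = \<zero>\<^bsub>Cinf M\<^esub>" if "Z \<in> Vect M" for Z
    using K(2) that by (simp add: metric_kernel_def)
  have XK: "nabla X K \<in> Vect M"
    by (intro affine_connection_closed[OF nabla] hom_vf_subset_Vect[OF X] hom_vf_subset_Vect[OF K(1)])
  have hom: "g (nabla X K) Z = \<zero>\<^bsub>Cinf M\<^esub>" if Z: "Z \<in> hom_vf M r" for Z r
  proof -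
    have ZV: "Z \<in> Vect M" by (rule hom_vf_subset_Vect[OF Z])
    then have "nabla X Z \<in> Vect M"
      by (rule affine_connection_closed[OF nabla hom_vf_subset_Vect[OF X]])
    moreover have "X ?T (g K Z) =
        g (nabla X K) Z \<oplus>\<^bsub>Cinf M\<^esub> scale (Cinf M) (ksign p q) (g K (nabla X Z))"
      using compat X K(1) Z unfolding metric_compatible_def by blast
    moreover have "g (nabla X K) Z \<in> carrier (Cinf M)"
      by (rule metric_closed[OF g XK ZV])
    ultimately show ?thesis
      using K0 ZV hom_vf_zero[OF X openin_topspace]
      by (simp add: supercomm_algebra_scale_zero_right[OF A])
  qed
  \<comment> \<open>Compatibility speaks of homogeneous fields only, so a general \<open>Y\<close>
    is split into its even and odd summands.\<close>
  have "g (nabla X K) Y = \<zero>\<^bsub>Cinf M\<^esub>" if Y: "Y \<in> Vect M" for Y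
  proof -
    obtain Y0 Y1 where Y01: "Y = vf_add M Y0 Y1" "Y0 \<in> hom_vf M 0" "Y1 \<in> hom_vf M 1"
      using Y unfolding Vect_def by blast
    have "g (nabla X K) Y = g (nabla X K) Y0 \<oplus>\<^bsub>Cinf M\<^esub> g (nabla X K) Y1"
      unfolding Y01(1) by (intro metric_add_right[OF g XK] hom_vf_subset_Vect[OF Y01(2)]
          hom_vf_subset_Vect[OF Y01(3)])
    then show ?thesis using hom Y01 by simp
  qed
  then show ?thesis using XK by (simp add: metric_kernel_def)
qed

text \<open>For odd Q the sign in the torsion is -1, so the two connection terms add up instead of
  cancelling, and the torsion on (Q, Q) is twice \<open>nabla Q Q\<close> minus 2 P.\<close>

lemma nabla_self_eq_if_torsionless:
  assumes torsionless: "torsionless M nabla" and nabla: "affine_connection M nabla"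
    and Q: "Q \<in> hom_vf M 1" and P: "P \<in> hom_vf M 0"
    and QQ: "vf_commutator M 1 1 Q Q = vf_scale M 2 P"
    and U: "openin (body M) U" and s: "s \<in> carrier (sheaf M U)"
  shows "nabla Q Q U s = P U s"
proof (rule supercomm_algebra_eq_if_double_eq[OF superalg_sheaf_supercomm_algebra[OF U]])
  show "nabla Q Q U s \<in> carrier (sheaf M U)"
    by (rule hom_vf_closed[OF affine_connection_hom_vf[OF nabla Q Q] U s])
  show "P U s \<in> carrier (sheaf M U)"
    by (rule hom_vf_closed[OF P U s])
  have "torsion M nabla 1 1 Q Q U s = vf_zero M U s"
    using torsionless Q unfolding torsionless_def by simp
  then show "(nabla Q Q U s \<oplus>\<^bsub>sheaf M U\<^esub>
        scale (sheaf M U) (- 1) (scale (sheaf M U) (- 1) (nabla Q Q U s))) \<oplus>\<^bsub>sheaf M U\<^esub>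
      scale (sheaf M U) (- 1) (scale (sheaf M U) 2 (P U s)) = \<zero>\<^bsub>sheaf M U\<^esub>"
    using U s unfolding torsion_def QQ
    by (simp add: vf_diff_def vf_add_def vf_scale_def vf_zero_def mk_vf_apply)
qed

end

section \<open>Derivatives and smoothness of constant and coordinate functions\<close>

lemma has_derivative_on_open_transform:
  assumes "open W" "x \<in> W" "(h has_derivative h') (at x)" "\<And>y. y \<in> W \<Longrightarrow> f y = h y"
  shows "(f has_derivative h') (at x)"
  using has_derivative_transform_within_open[OF assms(3,1,2)] assms(4) by simp

text \<open>Coefficients of sections are cut off to zero outside \<open>W\<close>, so they agree
  with a constant or a coordinate on \<open>W\<close> only. Openness of \<open>W\<close> makes this
  enough for derivatives at its points.\<close>

lemma frechet_derivative_const_on: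
  assumes "open W" "x \<in> W" "\<And>y. y \<in> W \<Longrightarrow> f y = c"
  shows "frechet_derivative f (at x) = (\<lambda>_. 0)"
  using frechet_derivative_at[OF has_derivative_on_open_transform
      [OF assms(1,2) has_derivative_const assms(3)]] by simp

lemma frechet_derivative_coord_on:
  fixes f :: "real ^ 'n \<Rightarrow> real"
  assumes "open W" "x \<in> W" "\<And>y. y \<in> W \<Longrightarrow> f y = y $ i"
  shows "(f has_derivative (\<lambda>v. v $ i)) (at x)" "frechet_derivative f (at x) = (\<lambda>v. v $ i)"
proof -
  have "((\<lambda>y::real^'n. y $ i) has_derivative (\<lambda>v. v $ i)) (at x)"
    by (rule bounded_linear.has_derivative[OF bounded_linear_vec_nth has_derivative_ident])
  from has_derivative_on_open_transform[OF assms(1,2) this assms(3)]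
  show "(f has_derivative (\<lambda>v. v $ i)) (at x)" .
  from frechet_derivative_at[OF this] show "frechet_derivative f (at x) = (\<lambda>v. v $ i)" by simp
qed

lemma Ck_on_const_on:
  assumes "open W" "\<And>y. y \<in> W \<Longrightarrow> f y = c"
  shows "Ck_on k W f"
  using assms(2)
\<comment> \<open>The partial derivatives are known to be zero on \<open>W\<close> only and may take
  any values elsewhere. The induction therefore ranges over all functions that are constant on
  \<open>W\<close>, and its hypothesis is used with the constant 0.\<close>
proof (induction k arbitrary: f c)
  case 0
  then show ?case by (simp cong: continuous_on_cong)
next
  case (Suc k)
  have "f differentiable_on W"
    unfolding differentiable_on_def
    using has_derivative_on_open_transform[OF assms(1) _ has_derivative_const Suc.prems]
    by (meson differentiableI differentiable_at_withinI)
  moreover have "Ck_on k W (\<lambda>x. frechet_derivative f (at x) (axis i 1))" for i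
    by (rule Suc.IH[of _ 0]) (simp add: frechet_derivative_const_on[OF assms(1) _ Suc.prems])
  ultimately show ?case by simp
qed

lemma Ck_on_coord_on:
  assumes "open W" "\<And>y. y \<in> W \<Longrightarrow> f y = y $ i"
  shows "Ck_on k W f"
proof (cases k)
  case 0
  have "continuous_on W (\<lambda>y. y $ i)" by (intro continuous_intros)
  then show ?thesis using 0 assms(2) by (simp cong: continuous_on_cong)
next
  case (Suc l)
  have "f differentiable_on W"
    unfolding differentiable_on_def
    using frechet_derivative_coord_on(1)[OF assms(1) _ assms(2)]
    by (meson differentiableI differentiable_at_withinI)
  moreover have "Ck_on l W (\<lambda>x. frechet_derivative f (at x) (axis j 1))" for j
    by (rule Ck_on_const_on[OF assms(1)])
      (simp add: frechet_derivative_coord_on(2)[OF assms(1) _ assms(2)])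
  ultimately show ?thesis using Suc by simp
qed

section \<open>Coordinate sections of superdomains and their pull-backs to Shander charts\<close>

definition even_coord :: "'n \<Rightarrow> (real ^ 'n) set \<Rightarrow> 'n grass" where
  "even_coord i W = (\<lambda>I x. if I = {} \<and> x \<in> W then x $ i else 0)"

lemma odd_coord_in_carrier:
  assumes "open W" "j < q" shows "odd_coord j W \<in> carrier (grass_alg q W)"
proof -
  have "Cinfinity_on W (odd_coord j W I)" for I
    unfolding Cinfinity_on_def
    by (intro allI Ck_on_const_on[OF assms(1), where c = "if I = {j} then 1 else 0"])
      (simp add: odd_coord_def)
  then show ?thesis using assms(2) by (auto simp: grass_alg_def odd_coord_def)
qed

lemma even_coord_in_carrier:
  assumes "open W" shows "even_coord i W \<in> carrier (grass_alg q W)"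
proof -
  have "Cinfinity_on W (even_coord i W I)" for I
  proof (cases "I = {}")
    case True
    then show ?thesis unfolding Cinfinity_on_def
      by (intro allI Ck_on_coord_on[OF assms, where i = i]) (simp add: even_coord_def)
  next
    case False
    then show ?thesis unfolding Cinfinity_on_def
      by (intro allI Ck_on_const_on[OF assms, where c = 0]) (simp add: even_coord_def)
  qed
  then show ?thesis by (auto simp: grass_alg_def even_coord_def)
qed

lemma zero_in_carrier_grass_alg:
  assumes "open W" shows "\<zero>\<^bsub>grass_alg q W\<^esub> \<in> carrier (grass_alg q W)"
  using Ck_on_const_on[OF assms, where c = 0]
  by (simp add: grass_alg_def Cinfinity_on_def)

text \<open>Each coefficient of \<open>odd_coord\<close> is constant on \<open>W\<close>. The zero
  of \<open>grass_alg q W\<close> is the same function for every \<open>q\<close>, and so is its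
  one; later uses therefore fix \<open>q\<close> explicitly.\<close>

lemma pd_even_odd_coord:
  assumes "open W" shows "pd_even i W (odd_coord j W) = \<zero>\<^bsub>grass_alg q W\<^esub>"
proof -
  have "frechet_derivative (odd_coord j W I) (at x) = (\<lambda>_. 0)" if "x \<in> W" for I x
    by (rule frechet_derivative_const_on[OF assms that, where c = "if I = {j} then 1 else 0"])
      (simp add: odd_coord_def)
  then show ?thesis by (auto simp: pd_even_def grass_alg_def fun_eq_iff)
qed

lemma pd_even_even_coord:
  assumes "open W" shows "pd_even i W (even_coord i W) = \<one>\<^bsub>grass_alg q W\<^esub>"
proof -
  have "frechet_derivative (even_coord i W {}) (at x) = (\<lambda>v. v $ i)" if "x \<in> W" for x
    by (rule frechet_derivative_coord_on(2)[OF assms that]) (simp add: even_coord_def)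
  moreover have "frechet_derivative (even_coord i W I) (at x) = (\<lambda>_. 0)"
    if "x \<in> W" "I \<noteq> {}" for I x
    using that by (intro frechet_derivative_const_on[OF assms]) (simp_all add: even_coord_def)
  ultimately show ?thesis by (auto simp: pd_even_def grass_alg_def fun_eq_iff)
qed

text \<open>The derivative at an index set without \<open>j\<close> reads the coefficient at
  \<open>insert j I\<close>, which is \<open>{j}\<close> for empty \<open>I\<close> only. There the
  sign is 1, since no index precedes \<open>j\<close>.\<close>

lemma pd_odd_odd_coord: "pd_odd j (odd_coord j W) = \<one>\<^bsub>grass_alg q W\<^esub>"
proof (intro ext)
  fix I x
  have "insert j I = {j} \<longleftrightarrow> I = {}" if "j \<notin> I" using that by auto
  then show "pd_odd j (odd_coord j W) I x = \<one>\<^bsub>grass_alg q W\<^esub> I x"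
    by (auto simp: pd_odd_def odd_coord_def grass_alg_def)
qed

lemma grass_alg_mult_zero_right: "F \<otimes>\<^bsub>grass_alg q W\<^esub> \<zero>\<^bsub>grass_alg q W\<^esub> = \<zero>\<^bsub>grass_alg q W\<^esub>"
  by (simp add: grass_alg_def)

lemma grass_alg_add_zero_right: "F \<oplus>\<^bsub>grass_alg q W\<^esub> \<zero>\<^bsub>grass_alg q W\<^esub> = F"
  by (simp add: grass_alg_def)

lemma grass_alg_one_neq_zero: "W \<noteq> {} \<Longrightarrow> \<one>\<^bsub>grass_alg q W\<^esub> \<noteq> \<zero>\<^bsub>grass_alg q W\<^esub>"
  by (auto simp: grass_alg_def fun_eq_iff)

lemma one_in_carrier_grass_alg:
  assumes "open W" shows "\<one>\<^bsub>grass_alg q W\<^esub> \<in> carrier (grass_alg q W)"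
proof -
  have "Ck_on k W (\<lambda>x. if I = {} \<and> x \<in> W then 1 else 0)" for k and I :: "nat set"
    by (rule Ck_on_const_on[OF assms, where c = "if I = {} then 1 else 0"]) simp
  then show ?thesis by (auto simp: grass_alg_def Cinfinity_on_def)
qed

text \<open>The witnesses are the pull-backs of \<open>odd_coord 0 V\<close> and
  \<open>even_coord i V\<close>. On the former, the second term of Q = d/dtau + tau d/dt vanishes
  because tau does not depend on t. One differs from zero over \<open>U\<close> because
  \<open>V\<close> is nonempty, as \<open>m\<close> lies in \<open>U\<close>, and the pull-back is
  injective.\<close>

lemma shander_chart_coordinates:
  fixes M :: "('a, 's) superspace" and V :: "(real ^ 'n::finite) set"
  assumes M: "superalg_sheaf M" and chart: "shander_chart M Q P U V \<phi> \<Phi> i" and m: "m \<in> U"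
  obtains \<tau> t where "\<tau> \<in> carrier (sheaf M U)" "t \<in> carrier (sheaf M U)"
    "Q U \<tau> = \<one>\<^bsub>sheaf M U\<^esub>" "P U \<tau> = \<zero>\<^bsub>sheaf M U\<^esub>" "P U t = \<one>\<^bsub>sheaf M U\<^esub>"
    "\<one>\<^bsub>sheaf M U\<^esub> \<noteq> \<zero>\<^bsub>sheaf M U\<^esub>"
proof -
  let ?A = "grass_alg 1 V"
  have U: "openin (body M) U" and V: "open V"
    and iso: "superspace_iso (open_sub M U) (open_sub (Rsuper 1) V) \<phi> \<Phi>"
    using chart unfolding shander_chart_def by blast+
  have [simp]: "topspace (body M) \<inter> U = U"
    using openin_subset[OF U] by auto
  have "homeomorphic_map (subtopology (body M) U) (top_of_set V) \<phi>"
    using iso by (simp add: superspace_iso_def open_sub_def Rsuper_def)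
  then have image: "\<phi> ` U = V"
    using homeomorphic_imp_surjective_map[of "subtopology (body M) U" "top_of_set V" \<phi>] by simp
  have preim: "preim (open_sub M U) \<phi> V = U"
    using image by (auto simp: preim_def open_sub_def)
  have "openin (body (open_sub (Rsuper 1) V)) V"
    by (simp add: open_sub_def Rsuper_def)
  then have "\<Phi> V \<in> superalg_iso (sheaf (open_sub (Rsuper 1) V) V)
      (sheaf (open_sub M U) (preim (open_sub M U) \<phi> V))"
    using iso unfolding superspace_iso_def by blast
  then have \<Phi>: "\<Phi> V \<in> superalg_iso ?A (sheaf M U)"
    unfolding preim by (simp add: open_sub_def Rsuper_def)
  note A = superalg_sheaf_supercomm_algebra[OF M U]
  have ring_hom: "\<Phi> V \<in> ring_hom ?A (sheaf M U)"
    using \<Phi> by (simp add: superalg_iso_def superalg_hom_def)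
  have closed: "\<Phi> V F \<in> carrier (sheaf M U)" if "F \<in> carrier ?A" for F
    by (rule ring_hom_closed[OF ring_hom that])
  have one: "\<Phi> V \<one>\<^bsub>?A\<^esub> = \<one>\<^bsub>sheaf M U\<^esub>"
    by (rule ring_hom_one[OF ring_hom])
  have zero_A: "\<zero>\<^bsub>?A\<^esub> \<in> carrier ?A" by (rule zero_in_carrier_grass_alg[OF V])
  \<comment> \<open>Compatibility with the scalar 0 shows that zero is preserved, without going
    through the ring axioms for \<open>grass_alg\<close>.\<close>
  have "\<Phi> V (scale ?A 0 \<zero>\<^bsub>?A\<^esub>) = scale (sheaf M U) 0 (\<Phi> V \<zero>\<^bsub>?A\<^esub>)"
    using \<Phi> zero_A by (simp add: superalg_iso_def superalg_hom_def)
  moreover have "scale ?A 0 \<zero>\<^bsub>?A\<^esub> = \<zero>\<^bsub>?A\<^esub>" by (simp add: grass_alg_def)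
  ultimately have zero: "\<Phi> V \<zero>\<^bsub>?A\<^esub> = \<zero>\<^bsub>sheaf M U\<^esub>"
    using supercomm_algebra_scale_zero_left[OF A closed[OF zero_A]] by simp
  \<comment> \<open>The coordinate expressions are used over the largest test set,
    \<open>W = V\<close>, whose preimage is all of \<open>U\<close>.\<close>
  have QP: "Q U (\<Phi> V F) = \<Phi> V (pd_odd 0 F \<oplus>\<^bsub>?A\<^esub> odd_coord 0 V \<otimes>\<^bsub>?A\<^esub> pd_even i V F)"
    "P U (\<Phi> V F) = \<Phi> V (pd_even i V F)" if "F \<in> carrier ?A" for F
    using chart that V preim unfolding shander_chart_def Let_def
    by (metis order_refl)+
  have \<tau>: "odd_coord 0 V \<in> carrier ?A" by (simp add: odd_coord_in_carrier[OF V])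
  have t: "even_coord i V \<in> carrier ?A" by (rule even_coord_in_carrier[OF V])
  have "V \<noteq> {}" using image m by blast
  then have "\<Phi> V \<one>\<^bsub>?A\<^esub> \<noteq> \<Phi> V \<zero>\<^bsub>?A\<^esub>"
    using \<Phi> grass_alg_one_neq_zero[of V 1] zero_A one_in_carrier_grass_alg[OF V]
    by (auto simp: superalg_iso_def bij_betw_def dest: inj_onD)
  then show ?thesis
    using that[OF closed[OF \<tau>] closed[OF t]] one zero QP[OF \<tau>] QP[OF t]
    by (simp add: pd_even_odd_coord[OF V, where q = 1] pd_even_even_coord[OF V, where q = 1]
        pd_odd_odd_coord[where q = 1] grass_alg_mult_zero_right grass_alg_add_zero_right)
qed

text \<open>Over the empty set there is only one section, by the sheaf axiom for the empty cover.\<close>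

lemma superalg_sheaf_empty:
  assumes M: "superalg_sheaf M" and "s \<in> carrier (sheaf M {})" "t \<in> carrier (sheaf M {})"
  shows "s = t"
proof -
  have "\<forall>\<U>. (\<forall>V\<in>\<U>. openin (body M) V) \<longrightarrow>
        (\<forall>s. (\<forall>V\<in>\<U>. s V \<in> carrier (sheaf M V)) \<and>
             (\<forall>V\<in>\<U>. \<forall>W\<in>\<U>. res M V (V \<inter> W) (s V) = res M W (V \<inter> W) (s W)) \<longrightarrow>
             (\<exists>!t. t \<in> carrier (sheaf M (\<Union>\<U>)) \<and> (\<forall>V\<in>\<U>. res M (\<Union>\<U>) V t = s V)))"
    using M unfolding superalg_sheaf_def by (elim conjE)
  from spec[OF this, of "{}"] show ?thesis using assms(2,3) by auto
qed

text \<open>Over an empty body the only open set is empty and carries a single section. Every vector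
  field is then zero, and the kernel cannot be larger than \<open>{vf_zero M}\<close>.\<close>

lemma degenerate_imp_nonempty:
  assumes M: "superalg_sheaf M" and g: "metric M g" and "degenerate M g"
  shows "topspace (body M) \<noteq> {}"
proof
  assume empty: "topspace (body M) = {}"
  have Cinf: "s = t" if "s \<in> carrier (Cinf M)" "t \<in> carrier (Cinf M)" for s t
    using superalg_sheaf_empty[OF M] that empty by simp
  have open_empty: "U = {}" if "openin (body M) U" for U
    using openin_subset[OF that] empty by simp
  have A: "supercomm_algebra (sheaf M {})"
    using superalg_sheaf_supercomm_algebra[OF M openin_empty] .
  interpret ring "sheaf M {}" by (rule supercomm_algebra_ring[OF A])
  have "X = vf_zero M" if X: "X \<in> Vect M" for X
  proof -
    obtain Y Z where X: "X = vf_add M Y Z" and YZ: "Y \<in> hom_vf M 0" "Z \<in> hom_vf M 1"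
      using X unfolding Vect_def by blast
    show ?thesis unfolding X vf_add_def vf_zero_def
    proof (rule mk_vf_cong)
      fix U s
      assume U: "openin (body M) U" and s: "s \<in> carrier (sheaf M U)"
      have "Y U s \<in> carrier (sheaf M U)" "Z U s \<in> carrier (sheaf M U)"
        by (rule hom_vf_closed[OF YZ(1) U s], rule hom_vf_closed[OF YZ(2) U s])
      then show "Y U s \<oplus>\<^bsub>sheaf M U\<^esub> Z U s = \<zero>\<^bsub>sheaf M U\<^esub>"
        using superalg_sheaf_empty[OF M] open_empty[OF U] by simp
    qed
  qed
  moreover have "vf_zero M \<in> metric_kernel M g"
  proof -
    have z: "vf_zero M \<in> Vect M"
      using hom_vf_subset_Vect[OF M vf_zero_in_hom_vf[OF M]] .
    have "\<zero>\<^bsub>Cinf M\<^esub> \<in> carrier (Cinf M)" using empty by simp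
    moreover have "g (vf_zero M) Y \<in> carrier (Cinf M)" if "Y \<in> Vect M" for Y
      by (rule metric_closed[OF g z that])
    ultimately show ?thesis using z Cinf unfolding metric_kernel_def by blast
  qed
  ultimately have "metric_kernel M g = {vf_zero M}"
    unfolding metric_kernel_def by blast
  then show False using assms(3) by (simp add: degenerate_def)
qed

section \<open>The contradiction in a Shander chart\<close>

theorem proposition2p10:
  fixes M :: "('a, 's) superspace"
    and g :: "('a, 's) pairing"
    and Q P :: "('a, 's) vfield"
    and nabla :: "('a, 's) connection"
  assumes "super_null TYPE('n::finite) M g Q P"
    and "affine_connection M nabla"
    and "metric_compatible M g nabla"
  shows "\<not> torsionless M nabla"
proof
  assume torsionless: "torsionless M nabla"
  let ?T = "topspace (body M)"
  have M: "superalg_sheaf M" and g: "metric M g" and degenerate: "degenerate M g"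
    and Q: "Q \<in> hom_vf M 1" and P: "P \<in> hom_vf M 0"
    and QQ: "vf_commutator M 1 1 Q Q = vf_scale M 2 P"
    and ker: "metric_kernel M g = {vf_smult M f Q | f. f \<in> carrier (Cinf M)}"
    and charts: "\<forall>m\<in>?T. \<exists>U (V :: (real ^ 'n) set) \<phi> \<Phi> i. m \<in> U \<and> shander_chart M Q P U V \<phi> \<Phi> i"
    using assms(1) unfolding super_null_def supermanifold_def by - (elim conjE, assumption)+
  \<comment> \<open>The charts are given around points, so a point is needed first; degeneracy of
    the metric supplies it.\<close>
  obtain m where "m \<in> ?T"
    using degenerate_imp_nonempty[OF M g degenerate] by blast
  then obtain U and V :: "(real ^ 'n) set" and \<phi> \<Phi> i
    where m: "m \<in> U" and chart: "shander_chart M Q P U V \<phi> \<Phi> i"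
    using charts by blast
  have U: "openin (body M) U" using chart by (simp add: shander_chart_def)
  obtain \<tau> t where \<tau>: "\<tau> \<in> carrier (sheaf M U)" and t: "t \<in> carrier (sheaf M U)"
    and Q\<tau>: "Q U \<tau> = \<one>\<^bsub>sheaf M U\<^esub>" and P\<tau>: "P U \<tau> = \<zero>\<^bsub>sheaf M U\<^esub>" and Pt: "P U t = \<one>\<^bsub>sheaf M U\<^esub>"
    and one_neq_zero: "\<one>\<^bsub>sheaf M U\<^esub> \<noteq> \<zero>\<^bsub>sheaf M U\<^esub>"
    by (rule shander_chart_coordinates[OF M chart m])
  interpret Cinf: ring "Cinf M"
    by (rule supercomm_algebra_ring[OF superalg_sheaf_supercomm_algebra[OF M openin_topspace]])
  interpret ring "sheaf M U"
    by (rule supercomm_algebra_ring[OF superalg_sheaf_supercomm_algebra[OF M U]])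
  \<comment> \<open>\<open>Q\<close> is in its own span, with the global function 1 as
    coefficient.\<close>
  have "Q \<in> metric_kernel M g"
    unfolding ker using vf_smult_one[OF M Q] Cinf.one_closed by force
  then have "nabla Q Q \<in> metric_kernel M g"
    by (rule nabla_in_metric_kernel[OF M g assms(2,3) Q Q])
  then obtain f where f: "f \<in> carrier (Cinf M)" and QQf: "nabla Q Q = vf_smult M f Q"
    unfolding ker by blast
  let ?f = "res M ?T U f"
  have f_closed: "?f \<in> carrier (sheaf M U)"
    using superalg_sheaf_res_hom[OF M openin_topspace U openin_subset[OF U]] f
    by (auto simp: superalg_hom_def intro: ring_hom_closed)
  \<comment> \<open>Two expressions for \<open>nabla Q Q\<close> meet here: \<open>P\<close> by
    vanishing torsion and \<open>f\<close> times \<open>Q\<close> by membership in the kernel. Over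
    \<open>U\<close> the coefficient acts through its restriction \<open>?f\<close>.\<close>
  have P_eq: "P U s = ?f \<otimes>\<^bsub>sheaf M U\<^esub> Q U s" if "s \<in> carrier (sheaf M U)" for s
    using nabla_self_eq_if_torsionless[OF M torsionless assms(2) Q P QQ U that]
      QQf U that by (simp add: vf_smult_def mk_vf_apply)
  have "?f = \<zero>\<^bsub>sheaf M U\<^esub>"
    using P_eq[OF \<tau>] P\<tau> Q\<tau> f_closed by simp
  then have "P U t = \<zero>\<^bsub>sheaf M U\<^esub>"
    using P_eq[OF t] hom_vf_closed[OF Q U t] by simp
  then show False using Pt one_neq_zero by simp
qed

end
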